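(* Let $c\in\mathbb{R}^n$ and $f(x)=\langle c,x\rangle$. For all $y\in\mathcal{F}^*$, $$[(\phi_h)_*\nabla_Hf_{|\mathcal{F}}](y)=\Pi_{\mathcal{A}_0}c,$$ where $[(\phi_h)_*\nabla_Hf_{|\mathcal{F}}](y)=d\phi_h(\phi_h^{-1}(y))\,\nabla_Hf_{|\mathcal{F}}(\phi_h^{-1}(y))$ is the push forward of the vector field $\nabla_Hf_{|\mathcal{F}}$ by $\phi_h$.
   Context: Let $m<n$ be positive integers, $A\in\mathbb{R}^{m\times n}$ of full rank, $b\in\operatorname{Im}A$, $\mathcal{A}=\{x\in\mathbb{R}^n: Ax=b\}$, $\mathcal{A}_0=\ker A$. Let $C\subset\mathbb{R}^n$ be nonempty, open and convex, with $\mathcal{F}=C\cap\mathcal{A}\neq\emptyset$. $\Pi_{\mathcal{A}_0}$ is the Euclidean orthogonal projection onto $\mathcal{A}_0$. $\Gamma_0(\mathbb{R}^n)$ is the set of lower semicontinuous proper convex functions $\mathbb{R}^n\to\mathbb{R}\cup\{+\infty\}$. A function $h\in\Gamma_0(\mathbb{R}^n)$ is of Legendre type if it is differentiable on $\operatorname{int}\operatorname{dom}h$, $|\nabla h(x^j)|\to+\infty$ for every sequence $(x^j)\subset\operatorname{int}\operatorname{dom}h$ converging to a boundary point of $\operatorname{dom}h$, and $h$ is strictly convex on $\operatorname{int}\operatorname{dom}h$. The function $h\in\Gamma_0(\mathbb{R}^n)$ is assumed to satisfy: (i) $h$ is of Legendre type with $\operatorname{int}\operatorname{dom}h=C$; (ii)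 $h_{|C}\in\mathcal{C}^2(C;\mathbb{R})$ and $\nabla^2h(x)$ is symmetric positive definite for all $x\in C$; (iii) $x\mapsto\nabla^2h(x)$ is locally Lipschitz continuous on $C$. Set $H=\nabla^2h$ on $C$. $\nabla_Hf_{|\mathcal{F}}(x)=H(x)^{-1}[I-A^T(AH(x)^{-1}A^T)^{-1}AH(x)^{-1}]\nabla f(x)$ is the gradient of $f_{|\mathcal{F}}$ for the Riemannian metric $(u,v)^H_x=\langle H(x)u,v\rangle$ on $\mathcal{F}$ (tangent space $\mathcal{A}_0$). The Legendre transform coordinates mapping is $\phi_h:\mathcal{F}\to\mathcal{F}^*=\phi_h(\mathcal{F})\subset\mathcal{A}_0$, $\phi_h(x)=\Pi_{\mathcal{A}_0}\nabla h(x)$, which is a $\mathcal{C}^1$ diffeomorphism onto the open subset $\mathcal{F}^*$ of $\mathcal{A}_0$. *)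

theory Defs
  imports "HOL-Analysis.Analysis"
begin

text \<open>Here and in \<open>hessian\<close>: a total function, meaningful only at points of differentiability.\<close>

definition gradient :: "('a::real_inner \<Rightarrow> real) \<Rightarrow> 'a \<Rightarrow> 'a" where
  "gradient f x = (THE D. GDERIV f x :> D)"

definition hessian :: "(real^'n \<Rightarrow> real) \<Rightarrow> real^'n \<Rightarrow> real^'n^'n" where
  "hessian f x = jacobian (gradient f) (at x)"

definition sym_pos_def :: "real^'n^'n \<Rightarrow> bool" where
  "sym_pos_def M \<longleftrightarrow> transpose M = M \<and> (\<forall>v. v \<noteq> 0 \<longrightarrow> v \<bullet> (M *v v) > 0)"

definition C2_on :: "(real^'n) set \<Rightarrow> (real^'n \<Rightarrow> real) \<Rightarrow> bool" where
  "C2_on S f \<longleftrightarrow>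
     (\<forall>x\<in>S. f differentiable (at x)) \<and>
     (\<forall>x\<in>S. gradient f differentiable (at x)) \<and>
     continuous_on S (hessian f)"

definition locally_lipschitz_on :: "('a::metric_space) set \<Rightarrow> ('a \<Rightarrow> 'b::metric_space) \<Rightarrow> bool" where
  "locally_lipschitz_on S g \<longleftrightarrow>
     (\<forall>x\<in>S. \<exists>u>0. \<exists>L. lipschitz_on L (ball x u \<inter> S) g)"

definition orth_proj :: "'a::euclidean_space set \<Rightarrow> 'a \<Rightarrow> 'a" where
  "orth_proj S x = (THE p. p \<in> S \<and> (\<forall>s\<in>S. orthogonal (x - p) s))"

definition mat_kernel :: "real^'n^'m \<Rightarrow> (real^'n) set" where
  "mat_kernel A = {x. A *v x = 0}"

definition domain :: "('a \<Rightarrow> ereal) \<Rightarrow> 'a set" where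
  "domain h = {x. h x < \<infinity>}"

text \<open>In the convexity inequality no \<open>\<infinity> - \<infinity>\<close> can occur, since \<open>h\<close> never takes the
  value \<open>-\<infinity>\<close>; \<open>ereal\<close> has \<open>0 * \<infinity> = 0\<close>, so the endpoint cases are trivial.\<close>

definition Gamma0 :: "('a::real_normed_vector \<Rightarrow> ereal) \<Rightarrow> bool" where
  "Gamma0 h \<longleftrightarrow>
     (\<forall>x. h x \<noteq> -\<infinity>) \<and> domain h \<noteq> {} \<and>
     (\<forall>x. h x \<le> Liminf (nhds x) h) \<and>
     (\<forall>x y. \<forall>t\<in>{0..1}.
        h ((1 - t) *\<^sub>R x + t *\<^sub>R y) \<le> ereal (1 - t) * h x + ereal t * h y)"

text \<open>The real-valued function representing \<open>h\<close> on its domain.\<close>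

definition fin_part :: "('a \<Rightarrow> ereal) \<Rightarrow> 'a \<Rightarrow> real" where
  "fin_part h = (\<lambda>x. real_of_ereal (h x))"

definition strictly_convex_on :: "'a::real_vector set \<Rightarrow> ('a \<Rightarrow> real) \<Rightarrow> bool" where
  "strictly_convex_on S f \<longleftrightarrow> convex S \<and>
     (\<forall>x\<in>S. \<forall>y\<in>S. \<forall>t\<in>{0<..<1}. x \<noteq> y \<longrightarrow>
        f ((1 - t) *\<^sub>R x + t *\<^sub>R y) < (1 - t) * f x + t * f y)"

definition legendre_type :: "('a::euclidean_space \<Rightarrow> ereal) \<Rightarrow> bool" where
  "legendre_type h \<longleftrightarrow>
     (\<forall>x \<in> interior (domain h). fin_part h differentiable (at x)) \<and>
     (\<forall>X l. (\<forall>j. X j \<in> interior (domain h)) \<longrightarrow> l \<in> frontier (domain h) \<longrightarrow>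
        X \<longlonglongrightarrow> l \<longrightarrow>
        filterlim (\<lambda>j. norm (gradient (fin_part h) (X j))) at_top sequentially) \<and>
     strictly_convex_on (interior (domain h)) (fin_part h)"

text \<open>\<open>riem_gradient A H f\<close> is the gradient of \<open>f\<close>, restricted to a relatively open subset of a
  translate of \<open>ker A\<close>, for the metric \<open>(u, v)\<^sub>x = \<langle>H(x) u, v\<rangle>\<close>; see
  \<open>riem_gradient_tangent\<close> and \<open>riem_gradient_inner\<close> below.\<close>

definition riem_gradient ::
    "real^'n^'m \<Rightarrow> (real^'n \<Rightarrow> real^'n^'n) \<Rightarrow> (real^'n \<Rightarrow> real) \<Rightarrow> real^'n \<Rightarrow> real^'n" where
  "riem_gradient A H f x =
     (matrix_inv (H x) **
       (mat 1 - transpose A ** matrix_inv (A ** matrix_inv (H x) ** transpose A)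
                  ** A ** matrix_inv (H x))) *v gradient f x"

definition legendre_coord :: "real^'n^'m \<Rightarrow> (real^'n \<Rightarrow> ereal) \<Rightarrow> real^'n \<Rightarrow> real^'n" where
  "legendre_coord A h x = orth_proj (mat_kernel A) (gradient (fin_part h) x)"

text \<open>Push-forward of the vector field \<open>V\<close> on \<open>F\<close> by \<open>\<phi>\<close>, as a field on \<open>\<phi> ` F\<close>. When \<open>F\<close> is
  relatively open in an affine subspace, \<open>frechet_derivative \<phi> (at x within F)\<close> is determined
  only on the direction space (the tangent space of \<open>F\<close>), where it is the differential of
  \<open>\<phi>\<close>; see \<open>differential_unique\<close> below. It is meant to be applied to tangent fields \<open>V\<close>.\<close>

definition pushforward ::
    "('a::real_normed_vector \<Rightarrow> 'b::real_normed_vector) \<Rightarrow> 'a set \<Rightarrow> ('a \<Rightarrow> 'a) \<Rightarrow> 'b \<Rightarrow> 'b" where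
  "pushforward \<phi> F V y =
     (let x = inv_into F \<phi> y in frechet_derivative \<phi> (at x within F) (V x))"

lemma gradient_eqI:
  assumes "GDERIV f x :> D"
  shows "gradient f x = D"
  unfolding gradient_def
proof (rule the_equality)
  fix E assume "GDERIV f x :> E"
  then have "(\<lambda>v. v \<bullet> E) = (\<lambda>v. v \<bullet> D)"
    using assms by (auto simp: gderiv_def intro: has_derivative_unique)
  then have "(E - D) \<bullet> E = (E - D) \<bullet> D" by meson
  then have "(E - D) \<bullet> (E - D) = 0" by (simp add: inner_diff_right)
  then show "E = D" by simp
qed (fact assms)

lemma orth_proj_works:
  fixes S :: "'a::euclidean_space set"
  assumes "subspace S"
  shows "orth_proj S x \<in> S \<and> (\<forall>s\<in>S. orthogonal (x - orth_proj S x) s)"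
  unfolding orth_proj_def
proof (rule theI')
  obtain p z where p: "p \<in> span S" "\<And>w. w \<in> span S \<Longrightarrow> orthogonal z w" "x = p + z"
    using orthogonal_subspace_decomp_exists[of S x] by metis
  have sp: "span S = S" using assms by (simp add: span_eq_iff)
  show "\<exists>!p. p \<in> S \<and> (\<forall>s\<in>S. orthogonal (x - p) s)"
  proof (rule ex1I[of _ p])
    show "p \<in> S \<and> (\<forall>s\<in>S. orthogonal (x - p) s)" using p sp by auto
    fix q assume q: "q \<in> S \<and> (\<forall>s\<in>S. orthogonal (x - q) s)"
    have "q - p \<in> S" using q p sp assms by (auto intro: subspace_diff)
    then have "orthogonal (x - q) (q - p)" "orthogonal (x - p) (q - p)"
      using q p sp by auto
    then have "(q - p) \<bullet> (q - p) = 0"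
      by (simp add: orthogonal_def inner_diff_left)
    then show "q = p" by simp
  qed
qed

lemma sym_pos_def_invertible:
  fixes M :: "real^'n^'n"
  assumes "\<And>v. v \<noteq> 0 \<Longrightarrow> v \<bullet> (M *v v) > 0"
  shows "M ** matrix_inv M = mat 1" "matrix_inv M ** M = mat 1"
proof -
  have "\<And>v. M *v v = 0 \<Longrightarrow> v = 0"
    by (metis assms inner_zero_right less_irrefl)
  then have "invertible M"
    by (simp add: invertible_left_inverse matrix_left_invertible_ker)
  then have "\<exists>N. M ** N = mat 1 \<and> N ** M = mat 1"
    by (simp add: invertible_def)
  then have "M ** matrix_inv M = mat 1 \<and> matrix_inv M ** M = mat 1"
    unfolding matrix_inv_def by (rule someI_ex)
  then show "M ** matrix_inv M = mat 1" "matrix_inv M ** M = mat 1" by auto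
qed

lemma inner_transpose_mult:
  fixes A :: "real^'n^'m"
  shows "(transpose A *v u) \<bullet> v = u \<bullet> (A *v v)"
  by (simp add: dot_lmul_matrix)

lemma riem_gradient_aux:
  fixes A :: "real^'n^'m"
  assumes spd: "sym_pos_def (H x)" and rk: "rank A = CARD('m)"
  shows "(A ** matrix_inv (H x) ** transpose A)
           ** matrix_inv (A ** matrix_inv (H x) ** transpose A) = mat 1"
proof (rule sym_pos_def_invertible(1))
  let ?M = "H x" let ?N = "matrix_inv (H x)"
  have MN: "?M ** ?N = mat 1"
    using spd by (intro sym_pos_def_invertible) (auto simp: sym_pos_def_def)
  have inj: "inj ((*v) (transpose A))"
    using rk by (metis full_rank_injective rank_transpose)
  fix v :: "real^'m" assume "v \<noteq> 0"
  then have nz: "transpose A *v v \<noteq> 0"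
    using inj by (metis injD matrix_vector_mult_0_right)
  let ?w = "?N *v (transpose A *v v)"
  have Mw: "?M *v ?w = transpose A *v v"
    by (simp only: matrix_vector_mul_assoc MN matrix_mul_assoc matrix_mul_lid)
  then have "?w \<noteq> 0" using nz by (metis matrix_vector_mult_0_right)
  then have "?w \<bullet> (?M *v ?w) > 0" using spd by (simp add: sym_pos_def_def)
  then have "(transpose A *v v) \<bullet> ?w > 0" unfolding Mw by (simp only: inner_commute)
  then have "v \<bullet> (A *v ?w) > 0" by (simp only: inner_transpose_mult)
  then show "v \<bullet> ((A ** ?N ** transpose A) *v v) > 0"
    by (simp only: matrix_vector_mul_assoc matrix_mul_assoc)
qed

lemma riem_gradient_tangent:
  fixes A :: "real^'n^'m"
  assumes spd: "sym_pos_def (H x)" and rk: "rank A = CARD('m)"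
  shows "riem_gradient A H f x \<in> mat_kernel A"
proof -
  let ?N = "matrix_inv (H x)"
  let ?B = "A ** ?N ** transpose A"
  let ?z = "?N *v gradient f x"
  have "riem_gradient A H f x = ?N *v (gradient f x - transpose A *v (matrix_inv ?B *v (A *v ?z)))"
    unfolding riem_gradient_def
    by (simp only: matrix_vector_mult_diff_rdistrib matrix_vector_mul_lid
        flip: matrix_vector_mul_assoc)
  then have "A *v riem_gradient A H f x
      = A *v ?z - A *v (?N *v (transpose A *v (matrix_inv ?B *v (A *v ?z))))"
    by (simp only: matrix_vector_mult_diff_distrib)
  also have "A *v (?N *v (transpose A *v (matrix_inv ?B *v (A *v ?z))))
      = (?B ** matrix_inv ?B) *v (A *v ?z)"
    by (simp only: flip: matrix_vector_mul_assoc)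
  also have "\<dots> = A *v ?z"
    by (simp only: riem_gradient_aux[of H x A, OF spd rk] matrix_vector_mul_lid)
  finally show ?thesis by (simp add: mat_kernel_def)
qed

lemma riem_gradient_inner:
  fixes A :: "real^'n^'m"
  assumes spd: "sym_pos_def (H x)" and v: "v \<in> mat_kernel A"
  shows "(H x *v riem_gradient A H f x) \<bullet> v = gradient f x \<bullet> v"
proof -
  let ?N = "matrix_inv (H x)" and ?g = "gradient f x"
  let ?B = "A ** ?N ** transpose A"
  have HN: "H x ** ?N = mat 1"
    using spd by (intro sym_pos_def_invertible) (auto simp: sym_pos_def_def)
  have "H x *v riem_gradient A H f x
      = (mat 1 - transpose A ** matrix_inv ?B ** A ** ?N) *v ?g"
    unfolding riem_gradient_def
    by (simp only: matrix_vector_mul_assoc matrix_mul_assoc HN matrix_mul_lid)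
  also have "\<dots> = ?g - transpose A *v ((matrix_inv ?B ** A ** ?N) *v ?g)"
    by (simp only: matrix_vector_mult_diff_rdistrib matrix_vector_mul_lid
        matrix_vector_mul_assoc matrix_mul_assoc)
  finally show ?thesis
    using v by (simp only: inner_diff_left inner_transpose_mult mat_kernel_def mem_Collect_eq) simp
qed

lemma differential_unique:
  fixes A :: "real^'n^'m" and \<phi> :: "real^'n \<Rightarrow> 'b::real_normed_vector"
  assumes "open C" and x: "x \<in> C \<inter> {x. A *v x = b}" and u: "u \<in> mat_kernel A"
    and D: "(\<phi> has_derivative D) (at x within C \<inter> {x. A *v x = b})"
    and E: "(\<phi> has_derivative E) (at x within C \<inter> {x. A *v x = b})"
  shows "D u = E u"
proof -
  let ?F = "C \<inter> {x. A *v x = b}"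
  let ?T = "{t. x + t *\<^sub>R u \<in> ?F}"
  have T: "?T = (\<lambda>t. x + t *\<^sub>R u) -` C"
    using x u by (auto simp: mat_kernel_def matrix_vector_right_distrib scaleR_matrix_vector_assoc
        matrix_vector_mult_scaleR)
  have opn: "open ?T" unfolding T
    by (intro open_vimage \<open>open C\<close> continuous_intros)
  have 0: "0 \<in> ?T" using x by simp
  have l: "((\<lambda>t. x + t *\<^sub>R u) has_derivative (\<lambda>t. t *\<^sub>R u)) (at 0)"
    by (auto intro!: derivative_eq_intros)
  have "((\<lambda>t. \<phi> (x + t *\<^sub>R u)) has_derivative (\<lambda>t. D' (t *\<^sub>R u))) (at 0)"
    if "(\<phi> has_derivative D') (at x within ?F)" for D'
  proof -
    have l': "((\<lambda>t. x + t *\<^sub>R u) has_derivative (\<lambda>t. t *\<^sub>R u)) (at 0 within ?T)"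
      using l by (rule has_derivative_at_withinI)
    have "((\<lambda>t. \<phi> (x + t *\<^sub>R u)) has_derivative (\<lambda>t. D' (t *\<^sub>R u))) (at 0 within ?T)"
      by (rule has_derivative_in_compose[OF l'])
         (rule has_derivative_subset[of _ _ _ ?F], use that in auto)
    then show ?thesis by (simp only: at_within_open[OF 0 opn])
  qed
  from fun_cong[OF has_derivative_unique[OF this[OF D] this[OF E]], of 1]
  show ?thesis by simp
qed

end

theory Submission
  imports Defs
begin

text \<open>Write \<open>P\<close> for the projection onto \<open>ker A\<close>. Since
  \<open>P\<close> is linear, the chain rule gives the differential \<open>v |-> P (H(x) v)\<close>
  for \<open>legendre_coord\<close> (\<open>legendre_coord_has_derivative\<close>). By definition of
  the Riemannian gradient \<open>V\<close>, the vectors \<open>H(x) V(x)\<close> and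
  \<open>c\<close> have the same inner products with \<open>ker A\<close>, hence the same projection
  (\<open>orth_proj_cong\<close>). The factor \<open>H(x)\<close> from the differential thus cancels
  the metric, and the pushed-forward field is the constant \<open>P c\<close>.\<close>

lemma orth_proj_eqI:
  fixes S :: "'a::euclidean_space set"
  assumes "subspace S" and "p \<in> S" and "\<And>s. s \<in> S \<Longrightarrow> (x - p) \<bullet> s = 0"
  shows "orth_proj S x = p"
proof -
  let ?q = "orth_proj S x"
  note q = orth_proj_works[OF \<open>subspace S\<close>, of x]
  have "?q - p \<in> S"
    using q assms by (auto intro: subspace_diff)
  then have "(x - ?q) \<bullet> (?q - p) = 0" "(x - p) \<bullet> (?q - p) = 0"
    using q assms by (auto simp: orthogonal_def)
  then have "(?q - p) \<bullet> (?q - p) = 0"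
    by (simp add: inner_diff_left)
  then show ?thesis by simp
qed

text \<open>If \<open>x - y\<close> is orthogonal to \<open>S\<close>, the projection of
  \<open>y\<close> also satisfies the conditions that characterize the projection of
  \<open>x\<close>.\<close>

lemma orth_proj_cong:
  fixes S :: "'a::euclidean_space set"
  assumes "subspace S" and "\<And>s. s \<in> S \<Longrightarrow> x \<bullet> s = y \<bullet> s"
  shows "orth_proj S x = orth_proj S y"
  using orth_proj_works[OF \<open>subspace S\<close>, of y] assms
  by (intro orth_proj_eqI) (auto simp: orthogonal_def inner_diff_left)

lemma linear_orth_proj:
  fixes S :: "'a::euclidean_space set"
  assumes "subspace S"
  shows "linear (orth_proj S)"
proof (rule linearI)
  note w = orth_proj_works[OF assms]
  show "orth_proj S (x + y) = orth_proj S x + orth_proj S y" for x y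
    using w[of x] w[of y] assms
    by (intro orth_proj_eqI)
       (auto intro: subspace_add simp: orthogonal_def inner_diff_left inner_add_left)
  show "orth_proj S (r *\<^sub>R x) = r *\<^sub>R orth_proj S x" for r x
    using w[of x] assms
    by (intro orth_proj_eqI) (auto intro: subspace_scale simp: orthogonal_def inner_diff_left)
qed

lemma subspace_mat_kernel: "subspace (mat_kernel A)"
  by (auto simp: subspace_def mat_kernel_def matrix_vector_right_distrib matrix_vector_mult_scaleR)

lemma gradient_inner_left: "gradient (\<lambda>x. c \<bullet> x) x = c"
proof (rule gradient_eqI)
  show "GDERIV (\<lambda>x. c \<bullet> x) x :> c"
    unfolding gderiv_def by (auto intro!: derivative_eq_intros simp: inner_commute)
qed

text \<open>Chain rule: a bounded linear map commutes with differentiation, and the Hessian is the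
  Jacobian of the gradient. The derivative exists in the ambient space, so it restricts to any
  \<open>F\<close>.\<close>

lemma legendre_coord_has_derivative:
  assumes "gradient (fin_part h) differentiable (at x)"
  shows "(legendre_coord A h has_derivative
           (\<lambda>v. orth_proj (mat_kernel A) (hessian (fin_part h) x *v v))) (at x within F)"
proof -
  have "(gradient (fin_part h) has_derivative (*v) (hessian (fin_part h) x)) (at x)"
    using assms by (simp add: hessian_def jacobian_works)
  moreover have "bounded_linear (orth_proj (mat_kernel A))"
    by (intro linear_conv_bounded_linear[THEN iffD1] linear_orth_proj subspace_mat_kernel)
  ultimately show ?thesis
    unfolding legendre_coord_def
    by (blast intro: has_derivative_at_withinI bounded_linear.has_derivative)
qed

theorem proposition5p5:
  fixes A :: "real^'n^'m" and b :: "real^'m" and C :: "(real^'n) set"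
    and h :: "real^'n \<Rightarrow> ereal" and c :: "real^'n"
  assumes "CARD('m) < CARD('n)"
    and "rank A = CARD('m)"
    and "b \<in> range ((*v) A)"
    and "C \<noteq> {}" and "open C" and "convex C"
    and "C \<inter> {x. A *v x = b} \<noteq> {}"
    and "Gamma0 h"
    and "legendre_type h" and "interior (domain h) = C"
    and "C2_on C (fin_part h)"
    and "\<forall>x\<in>C. sym_pos_def (hessian (fin_part h) x)"
    and "locally_lipschitz_on C (hessian (fin_part h))"
  shows "\<forall>y \<in> legendre_coord A h ` (C \<inter> {x. A *v x = b}).
           pushforward (legendre_coord A h) (C \<inter> {x. A *v x = b})
             (riem_gradient A (hessian (fin_part h)) (\<lambda>x. c \<bullet> x)) y
           = orth_proj (mat_kernel A) c"
proof
  let ?F = "C \<inter> {x. A *v x = b}" and ?P = "orth_proj (mat_kernel A)"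
  let ?\<phi> = "legendre_coord A h" and ?H = "hessian (fin_part h)"
  let ?V = "riem_gradient A ?H (\<lambda>x. c \<bullet> x)"
  fix y assume "y \<in> ?\<phi> ` ?F"
  define x where "x = inv_into ?F ?\<phi> y"
  have x: "x \<in> ?F"
    unfolding x_def by (rule inv_into_into) fact
  then have spd: "sym_pos_def (?H x)" and "gradient (fin_part h) differentiable (at x)"
    using assms by (auto simp: C2_on_def)
  then have D: "(?\<phi> has_derivative (\<lambda>v. ?P (?H x *v v))) (at x within ?F)"
    by (intro legendre_coord_has_derivative)
  then have "(?\<phi> has_derivative frechet_derivative ?\<phi> (at x within ?F)) (at x within ?F)"
    using differentiableI frechet_derivative_works by blast
  \<comment> \<open>Within the affine slice \<open>?F\<close>, \<open>frechet_derivative\<close> is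
    an arbitrary choice off the tangent space; it agrees with the computed differential at
    \<open>?V x\<close> because \<open>?V x\<close> lies in \<open>mat_kernel A\<close>.\<close>
  then have "pushforward ?\<phi> ?F ?V y = ?P (?H x *v ?V x)"
    unfolding pushforward_def Let_def x_def[symmetric]
    by (rule differential_unique
          [OF \<open>open C\<close> x riem_gradient_tangent[of ?H, OF spd \<open>rank A = CARD('m)\<close>] _ D])
  \<comment> \<open>For \<open>v\<close> in the kernel, the metric identity gives
    \<open>(?H x *v ?V x) \<bullet> v = c \<bullet> v\<close>, as the linear objective has gradient
    \<open>c\<close>.\<close>
  also have "\<dots> = ?P c"
    by (rule orth_proj_cong[OF subspace_mat_kernel])
       (simp add: riem_gradient_inner[of ?H, OF spd] gradient_inner_left)
  finally show "pushforward ?\<phi> ?F ?V y = ?P c" .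
qed

end
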